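(* Let $(C,e,\lambda,\oplus)$ be a Catalan structure and let $h\colon C\to C$ be the map defined in the context. Then $h$ is an involution, i.e. $h(h(t))=t$ for all $t\in C$.
   Context: A Catalan structure is a quadruple $(C,e,\lambda,\oplus)$ where $C=\bigsqcup_{n\ge 0}C_n$ with $C_0=\{e\}$ ($|t|=n$ for $t\in C_n$), $\lambda\colon C_n\to C_{n+1}$, $\oplus\colon C_m\times C_n\to C_{m+n}$, $\oplus$ is associative with two-sided identity $e$, and every $t\in C$ can be written uniquely in exactly one of three forms: $t=e$; $t=\lambda(s)$ with $s\in C$ (indecomposable); $t=u\oplus v$ with $u$ indecomposable and $v\in C\setminus C_0$ (decomposable). Hence every nonempty $t$ is uniquely $\lambda(u)\oplus v$ ($v=e$ allowed). Put $\gamma(t)=t\oplus\lambda(e)$ and define $\ominus$ by $e\ominus v=v$, $\lambda(u)\ominus v=\lambda(u\ominus v)$, $(t\oplus u)\ominus v=t\oplus(u\ominus v)$ for $t,u\ne e$ (well defined; one may take $t$ indecomposable). The map $h$ is defined by $h(e)=e$, $h(\lambda(t))=\gamma(h(t))$, $h(u\oplus v)=h(v)\ominus h(u)$; equivalently $h(e)=e$ and $h(\lambda(u)\oplus v)=h(v)\ominus\gamma(h(u))$. *)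

theory Defs
  imports Main "HOL-Library.Disjoint_Sets"
begin

locale graded_structure =
  fixes C :: "nat \<Rightarrow> 'a set"
    and e :: 'a
    and lam :: "'a \<Rightarrow> 'a"
    and oplus :: "'a \<Rightarrow> 'a \<Rightarrow> 'a" (infixr "\<oplus>" 65)
  assumes disjoint_C: "disjoint_family C"
    and C_0: "C 0 = {e}"
    and lam_grade: "t \<in> C n \<Longrightarrow> lam t \<in> C (Suc n)"
    and oplus_grade: "s \<in> C m \<Longrightarrow> t \<in> C n \<Longrightarrow> s \<oplus> t \<in> C (m + n)"
begin

definition elems :: "'a set" where
  "elems = (\<Union>n. C n)"

definition indecomposables :: "'a set" where
  "indecomposables = lam ` elems"

definition decomposables :: "'a set" where
  "decomposables = {u \<oplus> v |u v. u \<in> indecomposables \<and> v \<in> elems - C 0}"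

end

text \<open>The last six assumptions say that every element has exactly one of the three
  forms and that it is so written in a unique way.\<close>

locale catalan_structure = graded_structure +
  assumes oplus_assoc:
      "s \<in> elems \<Longrightarrow> t \<in> elems \<Longrightarrow> u \<in> elems \<Longrightarrow> (s \<oplus> t) \<oplus> u = s \<oplus> (t \<oplus> u)"
    and oplus_e_left: "t \<in> elems \<Longrightarrow> e \<oplus> t = t"
    and oplus_e_right: "t \<in> elems \<Longrightarrow> t \<oplus> e = t"
    and elems_cases: "elems = {e} \<union> indecomposables \<union> decomposables"
    and e_not_indecomposable: "e \<notin> indecomposables"
    and e_not_decomposable: "e \<notin> decomposables"
    and indecomposable_not_decomposable: "indecomposables \<inter> decomposables = {}"
    and lam_inj: "inj_on lam elems"
    and oplus_inj: "inj_on (\<lambda>(u, v). u \<oplus> v) (indecomposables \<times> (elems - C 0))"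
begin

definition gamma :: "'a \<Rightarrow> 'a" where
  "gamma t = t \<oplus> lam e"

text \<open>The recursively defined maps are given by their graphs; outside \<^term>\<open>elems\<close> they are
  unspecified. In the third rule the left summand is taken indecomposable.\<close>

inductive ominus_graph :: "'a \<Rightarrow> 'a \<Rightarrow> 'a \<Rightarrow> bool" where
  e: "v \<in> elems \<Longrightarrow> ominus_graph e v v"
| lam: "u \<in> elems \<Longrightarrow> ominus_graph u v w \<Longrightarrow> ominus_graph (lam u) v (lam w)"
| oplus: "t \<in> indecomposables \<Longrightarrow> u \<in> elems - {e} \<Longrightarrow> ominus_graph u v w
    \<Longrightarrow> ominus_graph (t \<oplus> u) v (t \<oplus> w)"

definition ominus :: "'a \<Rightarrow> 'a \<Rightarrow> 'a" (infixr "\<ominus>" 65) where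
  "t \<ominus> v = (THE w. ominus_graph t v w)"

inductive h_graph :: "'a \<Rightarrow> 'a \<Rightarrow> bool" where
  e: "h_graph e e"
| step: "u \<in> elems \<Longrightarrow> v \<in> elems \<Longrightarrow> h_graph u u' \<Longrightarrow> h_graph v v'
    \<Longrightarrow> h_graph (lam u \<oplus> v) (v' \<ominus> gamma u')"

definition h :: "'a \<Rightarrow> 'a" where
  "h t = (THE y. h_graph t y)"

text \<open>Well-definedness: both maps satisfy the recursion equations of the paper
  and are determined on \<^term>\<open>elems\<close> by them.\<close>

lemma e_elems [simp]: "e \<in> elems"
  using C_0 by (auto simp: elems_def)

lemma lam_elems [simp]: "t \<in> elems \<Longrightarrow> lam t \<in> elems"
  using lam_grade by (auto simp: elems_def)

lemma oplus_elems [simp]: "s \<in> elems \<Longrightarrow> t \<in> elems \<Longrightarrow> s \<oplus> t \<in> elems"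
  using oplus_grade unfolding elems_def by blast

lemma lam_neq_e [simp]: "t \<in> elems \<Longrightarrow> lam t \<noteq> e"
  using e_not_indecomposable by (auto simp: indecomposables_def)

lemma grade_unique: "t \<in> C m \<Longrightarrow> t \<in> C n \<Longrightarrow> m = n"
  using disjoint_C by (auto simp: disjoint_family_on_def)

lemma grade_0_iff: "t \<in> C n \<Longrightarrow> t = e \<longleftrightarrow> n = 0"
  using C_0 grade_unique by blast

lemma oplus_neq_e:
  assumes "s \<in> elems" "t \<in> elems" "s \<noteq> e \<or> t \<noteq> e"
  shows "s \<oplus> t \<noteq> e"
proof -
  obtain m n where mn: "s \<in> C m" "t \<in> C n" using assms by (auto simp: elems_def)
  then have "m + n \<noteq> 0" using assms(3) grade_0_iff by auto
  with oplus_grade[OF mn] show ?thesis using grade_0_iff by blast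
qed

lemma elems_exhaust [consumes 1, case_names e lam oplus]:
  assumes "t \<in> elems"
  obtains "t = e" | u where "u \<in> elems" "t = lam u"
    | u v where "u \<in> elems" "v \<in> elems" "v \<noteq> e" "t = lam u \<oplus> v"
proof -
  consider "t = e" | "t \<in> indecomposables" | "t \<in> decomposables"
    using assms elems_cases by blast
  then show ?thesis
  proof cases
    case 3
    then obtain u v where "t = u \<oplus> v" "u \<in> indecomposables" "v \<in> elems - C 0"
      by (auto simp: decomposables_def)
    then show ?thesis using that(3) C_0 by (auto simp: indecomposables_def)
  qed (use that in \<open>auto simp: indecomposables_def\<close>)
qed

lemma elems_induct3 [consumes 1, case_names e lam oplus]:
  assumes "t \<in> elems"
    and "P e"
    and "\<And>u. u \<in> elems \<Longrightarrow> P u \<Longrightarrow> P (lam u)"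
    and "\<And>u v. u \<in> elems \<Longrightarrow> v \<in> elems \<Longrightarrow> v \<noteq> e \<Longrightarrow> P u \<Longrightarrow> P v \<Longrightarrow> P (lam u \<oplus> v)"
  shows "P t"
proof -
  obtain n where "t \<in> C n" using assms(1) by (auto simp: elems_def)
  then show ?thesis
  proof (induction n arbitrary: t rule: less_induct)
    case (less n)
    then have "t \<in> elems" by (auto simp: elems_def)
    then show ?case
    proof (cases rule: elems_exhaust)
      case e
      then show ?thesis using assms(2) by simp
    next
      case (lam u)
      then obtain k where k: "u \<in> C k" by (auto simp: elems_def)
      then have "n = Suc k" using lam lam_grade[OF k] grade_unique less.prems by simp
      then show ?thesis using less.IH[OF _ k] lam assms(3) by simp
    next
      case (oplus u v)
      then obtain k l where k: "u \<in> C k" "v \<in> C l" by (auto simp: elems_def)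
      then have n: "n = Suc k + l"
        using oplus oplus_grade[OF lam_grade[OF k(1)] k(2)] grade_unique less.prems by simp
      have "l \<noteq> 0" using k oplus grade_0_iff by blast
      then have "P u" "P v" using less.IH[of k u] less.IH[of l v] k n by auto
      then show ?thesis using oplus assms(4) by simp
    qed
  qed
qed

lemma elems_induct [consumes 1, case_names e step]:
  assumes "t \<in> elems"
    and "P e"
    and "\<And>u v. u \<in> elems \<Longrightarrow> v \<in> elems \<Longrightarrow> P u \<Longrightarrow> P v \<Longrightarrow> P (lam u \<oplus> v)"
  shows "P t"
  using assms(1)
proof (induction rule: elems_induct3)
  case (lam u)
  then show ?case using assms(3)[of u e] assms(2) by (simp add: oplus_e_right)
qed (use assms in auto)

lemma lam_eq_iff: "s \<in> elems \<Longrightarrow> t \<in> elems \<Longrightarrow> lam s = lam t \<longleftrightarrow> s = t"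
  using lam_inj by (auto simp: inj_on_def)

lemma lam_neq_oplus:
  "s \<in> elems \<Longrightarrow> t \<in> indecomposables \<Longrightarrow> v \<in> elems \<Longrightarrow> v \<noteq> e \<Longrightarrow> lam s \<noteq> t \<oplus> v"
  using indecomposable_not_decomposable C_0
  by (auto simp: indecomposables_def decomposables_def disjoint_iff)

lemma indec_oplus_eqD:
  "s \<in> indecomposables \<Longrightarrow> t \<in> indecomposables \<Longrightarrow> u \<in> elems \<Longrightarrow> u \<noteq> e \<Longrightarrow> v \<in> elems \<Longrightarrow> v \<noteq> e
    \<Longrightarrow> s \<oplus> u = t \<oplus> v \<Longrightarrow> s = t \<and> u = v"
  using inj_onD[OF oplus_inj, of "(s, u)" "(t, v)"] C_0 by simp

lemma lam_oplus_eqD: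
  assumes "s \<in> elems" "t \<in> elems" "u \<in> elems" "v \<in> elems" "lam s \<oplus> u = lam t \<oplus> v"
  shows "s = t \<and> u = v"
proof -
  have I: "lam s \<in> indecomposables" "lam t \<in> indecomposables"
    using assms by (auto simp: indecomposables_def)
  show ?thesis
  proof (cases "u = e")
    case True
    then have "lam s = lam t \<oplus> v" using assms by (simp add: oplus_e_right)
    then have "v = e" using lam_neq_oplus[of s "lam t" v] assms I by blast
    then show ?thesis using assms True lam_eq_iff[of s t] by (simp add: oplus_e_right)
  next
    case False
    then have "v \<noteq> e"
      using lam_neq_oplus[of t "lam s" u] assms I by (metis lam_elems oplus_e_right)
    then show ?thesis using indec_oplus_eqD[OF I] False assms lam_eq_iff[of s t] by blast
  qed
qed

lemma indec_elems [simp]: "t \<in> indecomposables \<Longrightarrow> t \<in> elems"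
  by (auto simp: indecomposables_def)

lemma indec_neq_e: "t \<in> indecomposables \<Longrightarrow> t \<noteq> e"
  using e_not_indecomposable by blast

lemma ominus_graph_unique: "ominus_graph t v w \<Longrightarrow> ominus_graph t v w' \<Longrightarrow> w = w'"
proof (induction arbitrary: w' rule: ominus_graph.induct)
  case (e v)
  from e(2) show ?case
  proof cases
    case (lam u2 w2)
    then show ?thesis using lam_neq_e[of u2] by simp
  next
    case (oplus t2 u2 w2)
    then show ?thesis using oplus_neq_e[of t2 u2] by simp
  qed simp
next
  case (lam u v w)
  from lam.prems show ?case
  proof cases
    case (lam u2 w2)
    then show ?thesis using lam.IH \<open>u \<in> elems\<close> lam_eq_iff by auto
  next
    case e
    then show ?thesis using lam_neq_e[of u] lam.hyps by simp
  next
    case (oplus t2 u2 w2)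
    then show ?thesis using lam_neq_oplus[of u t2 u2] lam.hyps by simp
  qed
next
  case (oplus t u v w)
  from oplus.prems show ?case
  proof cases
    case e
    then show ?thesis using oplus.hyps oplus_neq_e[of t u] by auto
  next
    case (lam u2 w2)
    then show ?thesis using oplus.hyps lam_neq_oplus[of u2 t u] by auto
  next
    case (oplus t2 u2 w2)
    then show ?thesis using oplus.IH oplus.hyps indec_oplus_eqD[of t t2 u u2] by auto
  qed
qed

lemma ominus_graph_exists: "t \<in> elems \<Longrightarrow> v \<in> elems \<Longrightarrow> \<exists>w. ominus_graph t v w"
proof (induction rule: elems_induct3)
  case e
  then show ?case using ominus_graph.e by blast
next
  case (lam u)
  then show ?case using ominus_graph.lam by blast
next
  case (oplus a b)
  then have "lam a \<in> indecomposables" by (simp add: indecomposables_def)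
  then show ?case using ominus_graph.oplus[of "lam a" b v] oplus by blast
qed

lemma ominus_eqI: "ominus_graph t v w \<Longrightarrow> t \<ominus> v = w"
  unfolding ominus_def using ominus_graph_unique by blast

lemma ominus_graph_ominus: "t \<in> elems \<Longrightarrow> v \<in> elems \<Longrightarrow> ominus_graph t v (t \<ominus> v)"
  using ominus_graph_exists ominus_eqI by metis

lemma ominus_e [simp]: "v \<in> elems \<Longrightarrow> e \<ominus> v = v"
  by (intro ominus_eqI ominus_graph.intros)

lemma ominus_lam: "u \<in> elems \<Longrightarrow> v \<in> elems \<Longrightarrow> lam u \<ominus> v = lam (u \<ominus> v)"
  by (intro ominus_eqI ominus_graph.intros ominus_graph_ominus)

lemma ominus_indec_oplus:
  "t \<in> indecomposables \<Longrightarrow> u \<in> elems - {e} \<Longrightarrow> v \<in> elems \<Longrightarrow> (t \<oplus> u) \<ominus> v = t \<oplus> (u \<ominus> v)"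
  by (intro ominus_eqI ominus_graph.intros ominus_graph_ominus) auto

lemma ominus_grade: "t \<in> elems \<Longrightarrow> t \<in> C m \<Longrightarrow> v \<in> C n \<Longrightarrow> t \<ominus> v \<in> C (m + n)"
proof (induction arbitrary: m rule: elems_induct3)
  case e
  then have "v \<in> elems" by (auto simp: elems_def)
  then show ?case using e grade_0_iff[of e m] by simp
next
  case (lam u)
  then have v: "v \<in> elems" by (auto simp: elems_def)
  obtain k where k: "u \<in> C k" using lam by (auto simp: elems_def)
  then have "m = Suc k" using lam.prems lam_grade[OF k] grade_unique by simp
  then show ?case using lam.IH[OF k] lam_grade lam v by (auto simp: ominus_lam)
next
  case (oplus a b)
  then have v: "v \<in> elems" by (auto simp: elems_def)
  obtain k l where k: "a \<in> C k" "b \<in> C l" using oplus by (auto simp: elems_def)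
  then have m: "m = Suc k + l"
    using oplus.prems oplus_grade[OF lam_grade[OF k(1)] k(2)] grade_unique by simp
  have "(lam a \<oplus> b) \<ominus> v = lam a \<oplus> (b \<ominus> v)"
    using oplus.hyps v by (intro ominus_indec_oplus) (auto simp: indecomposables_def)
  moreover have "lam a \<oplus> (b \<ominus> v) \<in> C (Suc k + (l + n))"
    using oplus_grade[OF lam_grade[OF k(1)] oplus.IH(2)[OF k(2)]] oplus.prems by simp
  ultimately show ?case using m by (simp add: add.assoc)
qed

lemma ominus_elems [simp]: "t \<in> elems \<Longrightarrow> v \<in> elems \<Longrightarrow> t \<ominus> v \<in> elems"
  using ominus_grade[of t] unfolding elems_def by blast

lemma ominus_oplus:
  assumes "t \<in> elems - {e}" "u \<in> elems - {e}" "v \<in> elems"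
  shows "(t \<oplus> u) \<ominus> v = t \<oplus> (u \<ominus> v)"
proof -
  have "t \<in> elems" "t \<noteq> e" using assms by auto
  then show ?thesis
  proof (induction rule: elems_induct3)
    case (lam a)
    then show ?case using assms ominus_indec_oplus by (auto simp: indecomposables_def)
  next
    case (oplus a b)
    have "((lam a \<oplus> b) \<oplus> u) \<ominus> v = lam a \<oplus> ((b \<oplus> u) \<ominus> v)"
      using oplus assms ominus_indec_oplus[of "lam a" "b \<oplus> u" v] oplus_neq_e[of b u]
      by (auto simp: indecomposables_def oplus_assoc)
    also have "\<dots> = (lam a \<oplus> b) \<oplus> (u \<ominus> v)" using oplus assms by (auto simp: oplus_assoc)
    finally show ?case .
  qed simp
qed

lemma ominus_unique:
  assumes "\<And>v. v \<in> elems \<Longrightarrow> f e v = v"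
    and "\<And>u v. u \<in> elems \<Longrightarrow> v \<in> elems \<Longrightarrow> f (lam u) v = lam (f u v)"
    and "\<And>t u v. t \<in> elems - {e} \<Longrightarrow> u \<in> elems - {e} \<Longrightarrow> v \<in> elems \<Longrightarrow> f (t \<oplus> u) v = t \<oplus> f u v"
    and "t \<in> elems" "v \<in> elems"
  shows "f t v = t \<ominus> v"
  using assms(4)
  by (induction rule: elems_induct3) (use assms ominus_lam ominus_oplus in auto)

lemma ominus_neq_e:
  assumes "t \<in> elems" "v \<in> elems" "t \<noteq> e"
  shows "t \<ominus> v \<noteq> e"
proof -
  obtain m n where mn: "t \<in> C m" "v \<in> C n" using assms by (auto simp: elems_def)
  then have "m + n \<noteq> 0" using assms(3) grade_0_iff by auto
  with ominus_grade[OF assms(1) mn] show ?thesis using grade_0_iff by blast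
qed

lemma ominus_e_right [simp]: "t \<in> elems \<Longrightarrow> t \<ominus> e = t"
  by (induction rule: elems_induct3) (auto simp: ominus_lam ominus_oplus)

lemma ominus_assoc:
  assumes "t \<in> elems" "u \<in> elems" "v \<in> elems"
  shows "(t \<ominus> u) \<ominus> v = t \<ominus> (u \<ominus> v)"
  using assms(1)
proof (induction rule: elems_induct3)
  case (oplus a b)
  then show ?case using assms ominus_neq_e[of b u] by (auto simp: ominus_oplus)
qed (use assms in \<open>auto simp: ominus_lam\<close>)

lemma gamma_elems [simp]: "t \<in> elems \<Longrightarrow> gamma t \<in> elems"
  by (simp add: gamma_def)

lemma h_graph_unique: "h_graph t y \<Longrightarrow> h_graph t y' \<Longrightarrow> y = y'"
proof (induction arbitrary: y' rule: h_graph.induct)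
  case e
  then show ?case
  proof cases
    case (step u v u' v')
    have "lam u \<oplus> v \<noteq> e"
      using oplus_neq_e[of "lam u" v] lam_neq_e[OF \<open>u \<in> elems\<close>] lam_elems[OF \<open>u \<in> elems\<close>]
        \<open>v \<in> elems\<close> by blast
    then show ?thesis using step(1) by metis
  qed simp
next
  case (step u v u' v')
  from step.prems show ?case
  proof cases
    case e
    then show ?thesis using step.hyps oplus_neq_e[of "lam u" v] by auto
  next
    case (step u2 v2 u2' v2')
    then show ?thesis using step.IH step.hyps lam_oplus_eqD[of u u2 v v2] by auto
  qed
qed

lemma h_graph_exists: "t \<in> elems \<Longrightarrow> \<exists>y. h_graph t y"
  by (induction rule: elems_induct) (auto intro: h_graph.intros)

lemma h_eqI: "h_graph t y \<Longrightarrow> h t = y"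
  unfolding h_def using h_graph_unique by blast

lemma h_graph_h: "t \<in> elems \<Longrightarrow> h_graph t (h t)"
  using h_graph_exists h_eqI by metis

lemma h_e [simp]: "h e = e"
  by (intro h_eqI h_graph.intros)

lemma h_lam_oplus: "u \<in> elems \<Longrightarrow> v \<in> elems \<Longrightarrow> h (lam u \<oplus> v) = h v \<ominus> gamma (h u)"
  by (intro h_eqI h_graph.intros h_graph_h)

lemma h_elems [simp]: "t \<in> elems \<Longrightarrow> h t \<in> elems"
  by (induction rule: elems_induct) (auto simp: h_lam_oplus)

lemma h_lam: "t \<in> elems \<Longrightarrow> h (lam t) = gamma (h t)"
  using h_lam_oplus[of t e] by (simp add: oplus_e_right)

lemma h_oplus:
  assumes "u \<in> elems" "v \<in> elems"
  shows "h (u \<oplus> v) = h v \<ominus> h u"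
  using assms(1)
  by (induction rule: elems_induct)
    (use assms in \<open>auto simp: oplus_e_left oplus_assoc h_lam_oplus ominus_assoc\<close>)

lemma h_unique:
  assumes "f e = e"
    and "\<And>t. t \<in> elems \<Longrightarrow> f (lam t) = gamma (f t)"
    and "\<And>u v. u \<in> elems - {e} \<Longrightarrow> v \<in> elems - {e} \<Longrightarrow> f (u \<oplus> v) = f v \<ominus> f u"
    and "t \<in> elems"
  shows "f t = h t"
  using assms(4)
  by (induction rule: elems_induct3) (use assms h_lam h_lam_oplus in auto)

end

end

theory Submission
  imports Defs
begin

text \<open>The map \<open>h\<close> is an anti-homomorphism from \<open>\<oplus>\<close> to \<open>\<ominus>\<close> that carries \<open>lam\<close> to \<open>gamma\<close>; it is
  an involution because it also is an anti-homomorphism from \<open>\<ominus>\<close> to \<open>\<oplus>\<close> that carries \<open>gamma\<close>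
  to \<open>lam\<close>.\<close>

context catalan_structure
begin

lemma h_neq_e:
  assumes "t \<in> elems" "t \<noteq> e"
  shows "h t \<noteq> e"
  using assms
proof (induction rule: elems_induct3)
  case (lam u)
  then show ?case by (simp add: h_lam gamma_def oplus_neq_e)
next
  case (oplus u v)
  then show ?case by (simp add: h_lam_oplus ominus_neq_e)
qed simp

text \<open>Since \<open>gamma t\<close> is \<open>t \<oplus> lam e\<close> and
  \<open>h (lam e) = lam e\<close>, reversal leaves \<open>lam e \<ominus> h t\<close>.\<close>

lemma h_gamma:
  assumes "t \<in> elems"
  shows "h (gamma t) = lam (h t)"
  using assms by (simp add: gamma_def h_oplus h_lam oplus_e_left ominus_lam)

lemma h_ominus:
  assumes "t \<in> elems" "v \<in> elems"
  shows "h (t \<ominus> v) = h v \<oplus> h t"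
  using assms(1)
proof (induction rule: elems_induct3)
  case e
  then show ?case using assms by (simp add: oplus_e_right)
next
  case (lam u)
  then show ?case using assms by (simp add: ominus_lam h_lam gamma_def oplus_assoc)
next
  case (oplus a b)
  have "h ((lam a \<oplus> b) \<ominus> v) = (h v \<oplus> h b) \<ominus> gamma (h a)"
    using oplus assms by (simp add: ominus_oplus h_lam_oplus)
  \<comment> \<open>\<open>ominus_oplus\<close> needs both summands different from \<open>e\<close>:
    \<open>h b\<close> is, because \<open>b\<close> is; \<open>h v\<close> may not be.\<close>
  also have "\<dots> = h v \<oplus> (h b \<ominus> gamma (h a))"
  proof (cases "h v = e")
    case True
    then show ?thesis using oplus by (simp add: oplus_e_left)
  next
    case False
    then show ?thesis using oplus assms by (simp add: ominus_oplus h_neq_e)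
  qed
  finally show ?case using oplus by (simp add: h_lam_oplus)
qed

lemma h_h:
  assumes "t \<in> elems"
  shows "h (h t) = t"
  using assms
  \<comment> \<open>Two reversals restore the order: \<open>h (h v \<ominus> gamma (h u))\<close>
    becomes \<open>lam (h (h u)) \<oplus> h (h v)\<close>.\<close>
  by (induction rule: elems_induct) (simp_all add: h_lam_oplus h_ominus h_gamma)

end

theorem theorem2p9:
  fixes C :: "nat \<Rightarrow> 'a set" and e :: 'a and lam :: "'a \<Rightarrow> 'a" and oplus :: "'a \<Rightarrow> 'a \<Rightarrow> 'a"
  assumes "catalan_structure C e lam oplus"
  shows "\<forall>t \<in> (\<Union>n. C n).
    catalan_structure.h C e lam oplus (catalan_structure.h C e lam oplus t) = t"
proof -
  interpret catalan_structure C e lam oplus by (fact assms)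
  show ?thesis using h_h by (simp add: elems_def)
qed

end
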